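(* Consider the original social welfare problem (SW) and the threshold-restricted bi-level social welfare problem (SW$'$) defined in the context. The optimal solutions to (SW$'$) and (SW) coincide, in the sense that the restrictions in (SW$'$) do not prevent the attainment of the global optimum: the optimal social welfare value of (SW$'$) equals the optimal social welfare value of (SW), and the optimum of (SW) is attained by an optimal solution of (SW$'$), completed by suitable lotteries $\delta_m^n$ for queue lengths $n\ge N_m$ under which group-$m$ drivers do not join at $n\ge N_m$.
   Context: Model. Passengers arrive at a terminal as a Poisson process of positive rate $\mu$. Drivers belong to $M$ groups; group-$m$ drivers arrive as independent Poisson processes of positive rates $\lambda_m$. Idle drivers may join a virtual queue of unlimited capacity; each arriving passenger is matched with the driver at the front of the queue (if any), who leaves. Parameters: $R_m$ is the utility a group-$m$ driver obtains from a terminal order; $T_d>0$ is the mean trip duration; $r>0$ is the drivers' utility-gaining rate outside the terminal; $\nu>0$ is the platform's profit rate outside the terminal. The platform chooses for each group $m$ a commission fee $p_m$ (independent of the queue length) and an entry position lottery $\Delta_m=\{\delta_m^n\}_n$, where $\delta_m^n=(\delta_m^{1,n},\dots,\delta_m^{n+1,n})$ is a probability distribution on $\{1,\dots,n+1\}$ used when the queue length upon arrival is $n$: a joining group-$m$ driver is inserted at position $l$ with probability $\delta_m^{l,n}$ ($l=1$ is the front), and the drivers previously at positions $l,\dots,n$ each move back one position. Drivers do not renege. $W_m^n$ is the expected waiting time in queue of a group-$m$ driver who joins at queue length $n$; $w_n^l$ is the expected waiting time of a driver who joins at queue length $n$ and is placed at position $l$; $\tilde\lambda_m^n$ is the rate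 at which group-$m$ drivers join at queue length $n$; $P_n$ is the steady-state probability of queue length $n$. Write $\Lambda_n=\sum_{c=1}^M\tilde\lambda_c^n$. Relations: (E1) $\tilde\lambda_m^n=\lambda_m\mathbf 1\bigl(R_m-p_m-r(T_d+W_m^n)\ge 0\bigr)$ for all $n\ge0$. (E2) $\sum_{l=1}^{n+1}\delta_m^{l,n}=1$ for all $n\ge 0$. (E3) $W_m^n=\sum_{l=1}^{n+1}\delta_m^{l,n}w_n^l$. (E4) For $n\ge1$, $2\le l\le n+1$: $$w_n^l=\sum_{m=1}^M\frac{\tilde\lambda_m^{n+1}}{\Lambda_{n+1}+\mu}\Bigl(\frac{1}{\Lambda_{n+1}+\mu}+\sum_{i=1}^{l}\delta_m^{i,n+1}w_{n+1}^{l+1}+\bigl(1-\sum_{i=1}^{l}\delta_m^{i,n+1}\bigr)w_{n+1}^l\Bigr)+\frac{\mu}{\Lambda_{n+1}+\mu}\Bigl(\frac1{\Lambda_{n+1}+\mu}+w_{n-1}^{l-1}\Bigr),$$ and for $n\ge0$: $$w_n^1=\sum_{m=1}^M\frac{\tilde\lambda_m^{n+1}}{\Lambda_{n+1}+\mu}\Bigl(\frac{1}{\Lambda_{n+1}+\mu}+\delta_m^{1,n+1}w_{n+1}^{2}+(1-\delta_m^{1,n+1})w_{n+1}^1\Bigr)+\frac{\mu}{\Lambda_{n+1}+\mu}\cdot\frac1{\Lambda_{n+1}+\mu}.$$ (E5) $P_0=\Bigl(1+\sum_{i=1}^\infty\prod_{j=1}^i\frac{\Lambda_{j-1}}{\mu}\Bigr)^{-1}$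 and $P_n=P_0\prod_{j=1}^n\frac{\Lambda_{j-1}}{\mu}$ for $n\ge1$. Problem (SW): maximize $\sum_{n=0}^{\infty}P_n\sum_{m=1}^M\tilde\lambda_m^n\bigl(R_m-(r+\nu)(T_d+W_m^n)\bigr)$ over $\{p_m\},\{\Delta_m\}$ subject to (E1)--(E5). Problem (SW$'$): the upper level chooses capacities $N_m\in\mathbb Z^+$, $m=1,\dots,M$. Given these, set $\hat N=\max_m N_m$ and replace (E1) by (T1) $\tilde\lambda_m^n=\lambda_m\mathbf 1(n<N_m)$, and replace (E4) by (T4) the first recursion of (E4) for $1\le n\le\hat N-2$, $2\le l\le n+1$; the second recursion of (E4) for $0\le n\le\hat N-2$; $w_{\hat N-1}^l=\frac1\mu+w_{\hat N-2}^{l-1}$ for $2\le l\le\hat N$; and $w_{\hat N-1}^1=\frac1\mu$. The lower level maximizes, over $\{p_m\},\{\Delta_m\},\{W_m^n\}$, the objective $$\sum_{m=1}^M\lambda_m\sum_{n=0}^{N_m-1}P_n\bigl(R_m-(r+\nu)(T_d+W_m^n)\bigr)$$ subject to (E2), (E3), (E5), (T1), (T4) and $R_m-p_m-r(T_d+W_m^n)\ge0$ for all $m$ and all $n\in\{0,\dots,N_m-1\}$ (only the lotteries at queue lengths below capacity matter here). The upper level maximizes the resulting lower-level optimal value over $\{N_m\}$.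
   Formalization: Capacities N_m may also be 0 (with N_m ≥ 1 the claim fails, e.g. if every R_m < (r+ν)T_d, where excluding all drivers by high fees is best); in (SW) the expected waiting times w are taken as the least non-negative solution of (E4), and the series in (E5) must converge. *)

theory Defs
  imports "HOL-Analysis.Analysis"
begin

text \<open>The driver groups are the elements of a finite type \<open>'m\<close>, so that
  \<open>M = CARD('m)\<close> is an arbitrary positive integer.\<close>

record 'm model =
  pax_rate :: real                \<comment> \<open>\<open>\<mu>\<close>\<close>
  drv_rate :: "'m \<Rightarrow> real"        \<comment> \<open>\<open>\<lambda>\<^sub>m\<close>\<close>
  order_utility :: "'m \<Rightarrow> real"   \<comment> \<open>\<open>R\<^sub>m\<close>\<close>
  trip_time :: real               \<comment> \<open>\<open>T\<^sub>d\<close>\<close>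
  outside_utility :: real         \<comment> \<open>\<open>r\<close>\<close>
  outside_profit :: real          \<comment> \<open>\<open>\<nu>\<close>\<close>

definition admissible_model :: "'m model \<Rightarrow> bool" where
  "admissible_model G \<longleftrightarrow> pax_rate G > 0 \<and> (\<forall>m. drv_rate G m > 0) \<and> trip_time G > 0 \<and>
     outside_utility G > 0 \<and> outside_profit G > 0"

text \<open>Decisions (fees and lotteries) together with the quantities tied to them by the
  constraints. Positions are counted from 1, and at queue length \<open>n\<close> only the positions
  \<open>1, \<dots>, n + 1\<close> are meaningful.\<close>

record 'm plan =
  fee :: "'m \<Rightarrow> real"                       \<comment> \<open>\<open>p\<^sub>m\<close>\<close>
  lottery :: "'m \<Rightarrow> nat \<Rightarrow> nat \<Rightarrow> real"     \<comment> \<open>\<open>lottery S m n l\<close> is \<open>\<delta>\<close> for group \<open>m\<close>, queue length \<open>n\<close>, position \<open>l\<close>\<close>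
  join_rate :: "'m \<Rightarrow> nat \<Rightarrow> real"          \<comment> \<open>\<open>\<lambda>\<close> with tilde; arguments \<open>m\<close>, \<open>n\<close>\<close>
  wait :: "'m \<Rightarrow> nat \<Rightarrow> real"               \<comment> \<open>\<open>W\<close>; arguments \<open>m\<close>, \<open>n\<close>\<close>
  pos_wait :: "nat \<Rightarrow> nat \<Rightarrow> real"          \<comment> \<open>\<open>w\<close>; arguments \<open>n\<close>, \<open>l\<close>\<close>
  prob :: "nat \<Rightarrow> real"                     \<comment> \<open>\<open>P\<^sub>n\<close>\<close>

definition total_join_rate :: "('m::finite) plan \<Rightarrow> nat \<Rightarrow> real" where
  "total_join_rate S n = (\<Sum>m\<in>UNIV. join_rate S m n)"

definition net_utility :: "'m model \<Rightarrow> 'm plan \<Rightarrow> 'm \<Rightarrow> nat \<Rightarrow> real" where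
  "net_utility G S m n =
     order_utility G m - fee S m - outside_utility G * (trip_time G + wait S m n)"

definition social_gain :: "'m model \<Rightarrow> 'm plan \<Rightarrow> 'm \<Rightarrow> nat \<Rightarrow> real" where
  "social_gain G S m n =
     order_utility G m
       - (outside_utility G + outside_profit G) * (trip_time G + wait S m n)"

definition rational_joining :: "'m model \<Rightarrow> 'm plan \<Rightarrow> bool" where
  "rational_joining G S \<longleftrightarrow>
     (\<forall>m n. join_rate S m n = drv_rate G m * of_bool (net_utility G S m n \<ge> 0))"

definition valid_lotteries :: "'m plan \<Rightarrow> bool" where
  "valid_lotteries S \<longleftrightarrow>
     (\<forall>m n. (\<forall>l\<in>{1..n+1}. 0 \<le> lottery S m n l) \<and> (\<Sum>l=1..n+1. lottery S m n l) = 1)"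

definition mean_wait :: "'m plan \<Rightarrow> bool" where
  "mean_wait S \<longleftrightarrow>
     (\<forall>m n. wait S m n = (\<Sum>l=1..n+1. lottery S m n l * pos_wait S n l))"

definition wait_eq_behind :: "('m::finite) model \<Rightarrow> 'm plan \<Rightarrow> nat \<Rightarrow> nat \<Rightarrow> bool" where
  "wait_eq_behind G S n l \<longleftrightarrow>
     (let \<gamma> = total_join_rate S (n+1) + pax_rate G in
      pos_wait S n l =
        (\<Sum>m\<in>UNIV. join_rate S m (n+1) / \<gamma> *
           (1 / \<gamma> + (\<Sum>i=1..l. lottery S m (n+1) i) * pos_wait S (n+1) (l+1)
                  + (1 - (\<Sum>i=1..l. lottery S m (n+1) i)) * pos_wait S (n+1) l))
        + pax_rate G / \<gamma> * (1 / \<gamma> + pos_wait S (n-1) (l-1)))"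

definition wait_eq_front :: "('m::finite) model \<Rightarrow> 'm plan \<Rightarrow> nat \<Rightarrow> bool" where
  "wait_eq_front G S n \<longleftrightarrow>
     (let \<gamma> = total_join_rate S (n+1) + pax_rate G in
      pos_wait S n 1 =
        (\<Sum>m\<in>UNIV. join_rate S m (n+1) / \<gamma> *
           (1 / \<gamma> + lottery S m (n+1) 1 * pos_wait S (n+1) 2
                  + (1 - lottery S m (n+1) 1) * pos_wait S (n+1) 1))
        + pax_rate G / \<gamma> * (1 / \<gamma>))"

definition wait_equations :: "('m::finite) model \<Rightarrow> 'm plan \<Rightarrow> bool" where
  "wait_equations G S \<longleftrightarrow>
     (\<forall>n\<ge>1. \<forall>l\<in>{2..n+1}. wait_eq_behind G S n l) \<and> (\<forall>n. wait_eq_front G S n)"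

definition nonneg_pos_wait :: "'m plan \<Rightarrow> bool" where
  "nonneg_pos_wait S \<longleftrightarrow> (\<forall>n. \<forall>l\<in>{1..n+1}. 0 \<le> pos_wait S n l)"

text \<open>The infinite linear system \<open>wait_equations\<close> does not determine the waiting times:
  if drivers join at arbitrarily long queues, it also has spurious, even negative, solutions.
  The expected waiting times (mean absorption times of the chain that follows a tagged driver)
  are its least non-negative solution; a real solution of this kind exists exactly if they are
  all finite.\<close>

definition expected_pos_wait :: "('m::finite) model \<Rightarrow> 'm plan \<Rightarrow> bool" where
  "expected_pos_wait G S \<longleftrightarrow> wait_equations G S \<and> nonneg_pos_wait S \<and>
     (\<forall>w. wait_equations G (S\<lparr>pos_wait := w\<rparr>) \<and> nonneg_pos_wait (S\<lparr>pos_wait := w\<rparr>) \<longrightarrow>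
        (\<forall>n. \<forall>l\<in>{1..n+1}. pos_wait S n l \<le> w n l))"

text \<open>Summability is the existence of a steady state. The series starts at \<open>i = 1\<close>, hence
  the shift to \<open>Suc i\<close>.\<close>

definition steady_state :: "('m::finite) model \<Rightarrow> 'm plan \<Rightarrow> bool" where
  "steady_state G S \<longleftrightarrow>
     summable (\<lambda>i. \<Prod>j=1..Suc i. total_join_rate S (j-1) / pax_rate G) \<and>
     prob S 0 = inverse (1 + (\<Sum>i. \<Prod>j=1..Suc i. total_join_rate S (j-1) / pax_rate G)) \<and>
     (\<forall>n\<ge>1. prob S n = prob S 0 * (\<Prod>j=1..n. total_join_rate S (j-1) / pax_rate G))"


subsection \<open>The original problem\<close>

definition sw_feasible :: "('m::finite) model \<Rightarrow> 'm plan \<Rightarrow> bool" where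
  "sw_feasible G S \<longleftrightarrow> rational_joining G S \<and> valid_lotteries S \<and> mean_wait S \<and>
     expected_pos_wait G S \<and> steady_state G S"

text \<open>The series converges absolutely for every feasible plan: \<open>wait S m n\<close> is
  non-negative, and rational joining bounds it wherever \<open>join_rate S m n\<close> is nonzero.\<close>

definition sw_objective :: "('m::finite) model \<Rightarrow> 'm plan \<Rightarrow> real" where
  "sw_objective G S =
     (\<Sum>n. prob S n * (\<Sum>m\<in>UNIV. join_rate S m n * social_gain G S m n))"

definition sw_value :: "('m::finite) model \<Rightarrow> ereal" where
  "sw_value G = (SUP S\<in>{S. sw_feasible G S}. ereal (sw_objective G S))"

definition sw_optimal :: "('m::finite) model \<Rightarrow> 'm plan \<Rightarrow> bool" where
  "sw_optimal G S \<longleftrightarrow> sw_feasible G S \<and>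
     (\<forall>S'. sw_feasible G S' \<longrightarrow> sw_objective G S' \<le> sw_objective G S)"


subsection \<open>The bi-level problem with capacities\<close>

text \<open>Capacity 0 (a group that is never admitted) is allowed: the original problem can exclude
  a group by a high fee, and this can be strictly optimal.\<close>

definition max_capacity :: "('m::finite \<Rightarrow> nat) \<Rightarrow> nat" where
  "max_capacity N = Max (range N)"

definition threshold_joining :: "'m model \<Rightarrow> ('m \<Rightarrow> nat) \<Rightarrow> 'm plan \<Rightarrow> bool" where
  "threshold_joining G N S \<longleftrightarrow> (\<forall>m n. join_rate S m n = drv_rate G m * of_bool (n < N m))"

text \<open>The ranges \<open>n \<le> max_capacity N - 2\<close> are written \<open>n + 2 \<le> max_capacity N\<close> to avoid
  truncated subtraction. If all capacities are 0, there is no condition.\<close>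

definition truncated_wait_equations ::
    "('m::finite) model \<Rightarrow> ('m \<Rightarrow> nat) \<Rightarrow> 'm plan \<Rightarrow> bool" where
  "truncated_wait_equations G N S \<longleftrightarrow>
     (\<forall>n l. 1 \<le> n \<and> n + 2 \<le> max_capacity N \<and> 2 \<le> l \<and> l \<le> n + 1 \<longrightarrow> wait_eq_behind G S n l) \<and>
     (\<forall>n. n + 2 \<le> max_capacity N \<longrightarrow> wait_eq_front G S n) \<and>
     (\<forall>l. 2 \<le> l \<and> l \<le> max_capacity N \<longrightarrow>
        pos_wait S (max_capacity N - 1) l
          = 1 / pax_rate G + pos_wait S (max_capacity N - 2) (l - 1)) \<and>
     (1 \<le> max_capacity N \<longrightarrow> pos_wait S (max_capacity N - 1) 1 = 1 / pax_rate G)"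

definition lower_feasible :: "('m::finite) model \<Rightarrow> ('m \<Rightarrow> nat) \<Rightarrow> 'm plan \<Rightarrow> bool" where
  "lower_feasible G N S \<longleftrightarrow> valid_lotteries S \<and> mean_wait S \<and> steady_state G S \<and>
     threshold_joining G N S \<and> truncated_wait_equations G N S \<and>
     (\<forall>m. \<forall>n<N m. net_utility G S m n \<ge> 0)"

definition lower_objective :: "('m::finite) model \<Rightarrow> ('m \<Rightarrow> nat) \<Rightarrow> 'm plan \<Rightarrow> real" where
  "lower_objective G N S =
     (\<Sum>m\<in>UNIV. drv_rate G m * (\<Sum>n<N m. prob S n * social_gain G S m n))"

definition lower_value :: "('m::finite) model \<Rightarrow> ('m \<Rightarrow> nat) \<Rightarrow> ereal" where
  "lower_value G N = (SUP S\<in>{S. lower_feasible G N S}. ereal (lower_objective G N S))"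

definition bilevel_value :: "('m::finite) model \<Rightarrow> ereal" where
  "bilevel_value G = (SUP N. lower_value G N)"

definition bilevel_optimal :: "('m::finite) model \<Rightarrow> ('m \<Rightarrow> nat) \<Rightarrow> 'm plan \<Rightarrow> bool" where
  "bilevel_optimal G N S \<longleftrightarrow>
     (\<forall>N'. lower_value G N' \<le> lower_value G N) \<and> lower_feasible G N S \<and>
     (\<forall>S'. lower_feasible G N S' \<longrightarrow> lower_objective G N S' \<le> lower_objective G N S)"

text \<open>\<open>S'\<close> arises from the solution \<open>(N, S)\<close> of the bi-level problem by choosing new lotteries
  only at queue lengths \<open>n \<ge> N m\<close>, where group \<open>m\<close> does not join.\<close>

definition completed_by :: "('m::finite \<Rightarrow> nat) \<Rightarrow> 'm plan \<Rightarrow> 'm plan \<Rightarrow> bool" where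
  "completed_by N S S' \<longleftrightarrow>
     fee S' = fee S \<and> prob S' = prob S \<and>
     (\<forall>m. \<forall>n<N m. (\<forall>l\<in>{1..n+1}. lottery S' m n l = lottery S m n l) \<and>
        wait S' m n = wait S m n \<and> join_rate S' m n = join_rate S m n) \<and>
     (\<forall>n<max_capacity N. \<forall>l\<in>{1..n+1}. pos_wait S' n l = pos_wait S n l) \<and>
     (\<forall>m. \<forall>n\<ge>N m. join_rate S' m n = 0)"

end

theory Submission
  imports Defs
begin

text \<open>
  By Little's law the average waiting cost of a plan depends only on its queue-length
  distribution: \<open>\<Sum>n. P n * (\<Sum>m. \<lambda> m n * W m n) = \<Sum>n. n * P n\<close>. Put \<open>h = r + \<nu>\<close> and
  \<open>b m = R m - h * T\<close>, where \<open>T\<close> is the mean trip duration. Then the social welfare is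
  \<open>\<Sum>n. P n * ((\<Sum>m. \<lambda> m n * b m) - h * n)\<close>, the average reward of a controlled birth-death chain
  in which admitting a group-\<open>m\<close> driver earns \<open>b m\<close> and each queued driver costs \<open>h\<close> per unit of
  time. Fees and lotteries matter only through who joins at which queue length.

  For capacities the law is an exact finite identity (\<open>lower_objective_eq\<close>). For the unbounded
  queue only one inequality is needed: if the welfare of a feasible plan exceeded the upper bound
  \<open>g\<close>, the remainder term of the partial sums would force the total expected waiting time of the
  drivers in queue to decrease linearly in the queue length, although it is non-negative
  (\<open>sw_objective_le\<close>).

  Let \<open>\<phi> v = \<Sum>m. \<lambda> m * max 0 (b m - v)\<close>. A sequence with \<open>u 0 = 0\<close> and
  \<open>\<phi> (u (k + 1)) \<le> g + h * k - \<mu> * u k\<close> that is bounded above certifies that no plan has welfare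
  above \<open>g\<close>; here \<open>u k\<close> plays the role of the loss in relative value caused by the \<open>k\<close>-th queued
  driver. Let \<open>g\<close> be the best welfare among threshold policies with capacities up to a constant,
  and define \<open>u\<close> by \<open>\<phi> (u (k + 1)) = max 0 (g + h * k - \<mu> * u k)\<close>. If the maximum with 0 were ever
  needed, first at \<open>k = n\<close>, then \<open>u\<close> would increase up to \<open>n\<close>, and the thresholds that admit group
  \<open>m\<close> while \<open>u (k + 1) \<le> b m\<close> and \<open>k < n\<close> would have welfare above \<open>g\<close>
  (\<open>improving_thresholds\<close>). Hence \<open>g\<close> bounds the welfare of every plan of either problem.

  Conversely, first come, first served realizes all capacities \<open>N\<close> at once: the waiting time
  \<open>(n + 1) / \<mu>\<close> increases with the queue length, so the fee that makes group \<open>m\<close> indifferent at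
  \<open>n + 1 = N m\<close> makes it join exactly for \<open>n < N m\<close>. This one plan is feasible for both problems
  and has the same objective value in both (\<open>fcfs_feasible\<close>, \<open>fcfs_objectives_eq\<close>), so with optimal
  capacities it is an optimum of both.
\<close>

section \<open>Partial sums over a birth-death chain\<close>

text \<open>Adding the drift \<open>a k * u (k + 1) - \<mu> * u k\<close> of a potential \<open>u\<close> changes a stationary average
  only by a boundary term. The lemma serves both Little's law and the optimality inequality.\<close>

lemma balanced_sum:
  fixes P a x u :: "nat \<Rightarrow> real"
  assumes bal: "\<And>k. \<mu> * P (Suc k) = a k * P k" and u0: "u 0 = 0"
  shows "(\<Sum>k<n. P k * x k) = (\<Sum>k<n. P k * (x k - a k * u (Suc k) + \<mu> * u k)) + \<mu> * P n * u n"
proof (induction n)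
  case 0
  then show ?case by (simp add: u0)
next
  case (Suc n)
  have "\<mu> * P (Suc n) * u (Suc n) = P n * (a n * u (Suc n))"
    unfolding bal by simp
  then show ?case using Suc by (simp add: right_diff_distrib distrib_left)
qed

lemma steady_state_balance:
  fixes G :: "('m::finite) model"
  assumes "steady_state G S" "pax_rate G > 0"
  shows "pax_rate G * prob S (Suc k) = total_join_rate S k * prob S k"
proof -
  have P: "prob S n = prob S 0 * (\<Prod>j=1..n. total_join_rate S (j-1) / pax_rate G)" for n
    using assms by (cases n) (auto simp: steady_state_def)
  show ?thesis using assms(2) by (simp add: P[of k] P[of "Suc k"])
qed

lemma steady_state_prob:
  fixes G :: "('m::finite) model"
  assumes ss: "steady_state G S" and mu: "pax_rate G > 0" and a: "\<And>n. 0 \<le> total_join_rate S n"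
  shows "prob S 0 > 0" and "prob S n \<ge> 0" and "prob S sums 1"
proof -
  let ?q = "\<lambda>n. \<Prod>j=1..n. total_join_rate S (j-1) / pax_rate G"
  have q: "?q n \<ge> 0" for n
    by (intro prod_nonneg) (use mu a in auto)
  have sm: "summable (\<lambda>i. ?q (Suc i))" and P0: "prob S 0 = inverse (1 + (\<Sum>i. ?q (Suc i)))"
    using ss by (auto simp: steady_state_def)
  have sn: "(\<Sum>i. ?q (Suc i)) \<ge> 0"
    by (intro suminf_nonneg sm q)
  have P: "prob S n = prob S 0 * ?q n" for n
    using ss by (cases n) (auto simp: steady_state_def)
  show pos: "prob S 0 > 0" using P0 sn by simp
  show "prob S n \<ge> 0" using P[of n] q[of n] pos by simp
  have "(\<lambda>i. ?q (Suc i)) sums (\<Sum>i. ?q (Suc i))" using sm by (rule summable_sums)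
  then have "?q sums ((\<Sum>i. ?q (Suc i)) + ?q 0)" by (subst (asm) sums_Suc_iff) simp
  then have "(\<lambda>n. prob S 0 * ?q n) sums (prob S 0 * ((\<Sum>i. ?q (Suc i)) + 1))"
    by (intro sums_mult) simp
  moreover have "prob S 0 * ((\<Sum>i. ?q (Suc i)) + 1) = 1"
    using P0 sn by (simp add: field_simps)
  ultimately show "prob S sums 1" using sums_cong[of "prob S", OF P] by simp
qed

section \<open>Little's law\<close>

text \<open>The total expected remaining waiting time of \<open>k\<close> queued drivers. With \<open>k\<close> drivers in queue
  (including a driver who has just joined), the driver at position \<open>l\<close> has waiting time
  \<open>pos_wait S (k - 1) l\<close>, since \<open>pos_wait\<close> is indexed by the queue length before joining. For
  \<open>k = 0\<close> the sum is empty.\<close>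

definition total_wait :: "'m plan \<Rightarrow> nat \<Rightarrow> real" where
  "total_wait S k = (\<Sum>l=1..k. pos_wait S (k - 1) l)"

text \<open>The increment of the total waiting time; at \<open>k = 0\<close> truncated subtraction makes it 0.\<close>

definition marginal_wait :: "'m plan \<Rightarrow> nat \<Rightarrow> real" where
  "marginal_wait S k = total_wait S k - total_wait S (k - 1)"

text \<open>The rate at which expected waiting time is brought in by drivers joining at queue length
  \<open>k\<close>.\<close>

definition waiting_flow :: "('m::finite) plan \<Rightarrow> nat \<Rightarrow> real" where
  "waiting_flow S k = (\<Sum>m\<in>UNIV. join_rate S m k * wait S m k)"

text \<open>When a driver is inserted according to the lottery \<open>p\<close>, the expected waiting times of the
  \<open>n\<close> drivers already present add up to the total over all \<open>n + 1\<close> positions minus the expected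
  waiting time of the newcomer.\<close>

lemma insertion_sum:
  fixes p y :: "nat \<Rightarrow> real"
  assumes "(\<Sum>l=1..Suc n. p l) = 1"
  shows "(\<Sum>l=1..n. (\<Sum>i=1..l. p i) * y (Suc l) + (1 - (\<Sum>i=1..l. p i)) * y l) =
    (\<Sum>l=1..Suc n. y l) - (\<Sum>l=1..Suc n. p l * y l)"
proof -
  have "(\<Sum>l=1..n. (\<Sum>i=1..l. p i) * y (Suc l) + (1 - (\<Sum>i=1..l. p i)) * y l) =
    (\<Sum>l=1..n. y l) - (\<Sum>l=1..n. p l * y l) + (\<Sum>i=1..n. p i) * y (Suc n)"
    by (induction n) (simp_all add: algebra_simps)
  moreover have "(\<Sum>i=1..n. p i) = 1 - p (Suc n)"
    using assms by simp
  then have "(\<Sum>i=1..n. p i) * y (Suc n) = y (Suc n) - p (Suc n) * y (Suc n)"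
    by (simp only: left_diff_distrib mult_1)
  ultimately show ?thesis by simp
qed

lemma waiting_flow_0:
  fixes S :: "('m::finite) plan"
  assumes "valid_lotteries S" "mean_wait S"
  shows "waiting_flow S 0 = total_join_rate S 0 * marginal_wait S 1"
proof -
  have "(\<Sum>l=1..0+1. lottery S m 0 l) = 1" for m
    using assms(1) unfolding valid_lotteries_def by blast
  then have "lottery S m 0 1 = 1" for m by simp
  then have "wait S m 0 = pos_wait S 0 1" for m
    using assms(2) unfolding mean_wait_def by simp
  then show ?thesis
    by (simp add: waiting_flow_def total_join_rate_def marginal_wait_def total_wait_def sum_distrib_right)
qed

text \<open>Summing the waiting-time recursion over all positions eliminates the lotteries.\<close>

lemma waiting_flow_Suc:
  fixes S :: "('m::finite) plan"
  assumes vl: "valid_lotteries S" and mw: "mean_wait S"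
    and mu: "pax_rate G > 0" and a: "0 \<le> total_join_rate S (Suc n)"
    and front: "wait_eq_front G S n"
    and behind: "\<And>l. 2 \<le> l \<Longrightarrow> l \<le> n + 1 \<Longrightarrow> wait_eq_behind G S n l"
  shows "waiting_flow S (Suc n) =
    real (Suc n) + total_join_rate S (Suc n) * marginal_wait S (Suc (Suc n)) - pax_rate G * marginal_wait S (Suc n)"
proof -
  define \<gamma> where "\<gamma> = total_join_rate S (Suc n) + pax_rate G"
  have g: "\<gamma> > 0" using mu a by (simp add: \<gamma>_def)
  define D where "D m l = (\<Sum>i=1..l. lottery S m (Suc n) i)" for m l
  define y where "y = pos_wait S (Suc n)"
  \<comment> \<open>A served driver leaves, which contributes waiting time 0 for the front position.\<close>
  define z where "z l = (if l = 1 then 0 else pos_wait S (n - 1) (l - 1))" for l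
  have scale: "\<gamma> * ((\<Sum>m\<in>UNIV. join_rate S m (Suc n) / \<gamma> * (1/\<gamma> + X m)) + pax_rate G / \<gamma> * (1/\<gamma> + c)) =
      1 + (\<Sum>m\<in>UNIV. join_rate S m (Suc n) * X m) + pax_rate G * c" for X :: "'m \<Rightarrow> real" and c
  proof -
    have "\<gamma> * ((\<Sum>m\<in>UNIV. join_rate S m (Suc n) / \<gamma> * (1/\<gamma> + X m)) + pax_rate G / \<gamma> * (1/\<gamma> + c)) =
       (\<Sum>m\<in>UNIV. join_rate S m (Suc n) * (1/\<gamma> + X m)) + pax_rate G * (1/\<gamma> + c)"
      using g by (simp add: distrib_left sum_distrib_left)
    also have "\<dots> = (total_join_rate S (Suc n) + pax_rate G) / \<gamma> + (\<Sum>m\<in>UNIV. join_rate S m (Suc n) * X m) + pax_rate G * c"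
      by (simp add: total_join_rate_def algebra_simps sum.distrib add_divide_distrib sum_divide_distrib)
    finally show ?thesis using g by (simp add: \<gamma>_def)
  qed
  have row: "\<gamma> * pos_wait S n l =
      1 + (\<Sum>m\<in>UNIV. join_rate S m (Suc n) * (D m l * y (Suc l) + (1 - D m l) * y l)) + pax_rate G * z l"
    if "l \<in> {1..Suc n}" for l
  proof (cases "l = 1")
    case True
    have "pos_wait S n 1 = (\<Sum>m\<in>UNIV. join_rate S m (Suc n) / \<gamma> *
           (1 / \<gamma> + (D m 1 * y (Suc 1) + (1 - D m 1) * y 1))) + pax_rate G / \<gamma> * (1 / \<gamma> + 0)"
      using front by (simp add: wait_eq_front_def Let_def \<gamma>_def D_def y_def numeral_2_eq_2 add.assoc)
    then show ?thesis using scale[of "\<lambda>m. D m 1 * y (Suc 1) + (1 - D m 1) * y 1" 0] True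
      by (simp add: z_def)
  next
    case False
    have "pos_wait S n l = (\<Sum>m\<in>UNIV. join_rate S m (Suc n) / \<gamma> *
           (1 / \<gamma> + (D m l * y (Suc l) + (1 - D m l) * y l))) + pax_rate G / \<gamma> * (1 / \<gamma> + z l)"
      using behind[of l] that False
      by (simp add: wait_eq_behind_def Let_def \<gamma>_def D_def y_def z_def add.assoc)
    then show ?thesis using scale[of "\<lambda>m. D m l * y (Suc l) + (1 - D m l) * y l" "z l"]
      by simp
  qed
  have zsum: "(\<Sum>l=1..Suc n. z l) = total_wait S n"
  proof -
    have "(\<Sum>l=1..Suc n. z l) = z 1 + (\<Sum>l=Suc 1..Suc n. z l)"
      by (rule sum.atLeast_Suc_atMost) simp
    also have "(\<Sum>l=Suc 1..Suc n. z l) = (\<Sum>l=1..n. z (Suc l))"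
      by (rule sum.shift_bounds_cl_Suc_ivl)
    also have "\<dots> = total_wait S n"
      unfolding total_wait_def by (intro sum.cong) (auto simp: z_def)
    finally show ?thesis by (simp add: z_def)
  qed
  have ins: "(\<Sum>l=1..Suc n. D m l * y (Suc l) + (1 - D m l) * y l) =
      total_wait S (Suc (Suc n)) - wait S m (Suc n)" for m
  proof -
    have "(\<Sum>l=1..Suc (Suc n). lottery S m (Suc n) l) = 1"
      using vl unfolding valid_lotteries_def by (metis Suc_eq_plus1)
    from insertion_sum[OF this, of y] show ?thesis
      using mw unfolding mean_wait_def D_def by (simp add: total_wait_def y_def)
  qed
  have "\<gamma> * total_wait S (Suc n) = (\<Sum>l=1..Suc n. \<gamma> * pos_wait S n l)"
    by (simp only: total_wait_def diff_Suc_1 sum_distrib_left)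
  also have "\<dots> = (\<Sum>l=1..Suc n. 1 + (\<Sum>m\<in>UNIV. join_rate S m (Suc n) * (D m l * y (Suc l) + (1 - D m l) * y l)) + pax_rate G * z l)"
    by (intro sum.cong row refl)
  also have "\<dots> = real (Suc n) + (\<Sum>l=1..Suc n. \<Sum>m\<in>UNIV. join_rate S m (Suc n) * (D m l * y (Suc l) + (1 - D m l) * y l))
      + pax_rate G * (\<Sum>l=1..Suc n. z l)"
    by (simp only: sum.distrib sum_distrib_left) simp
  also have "(\<Sum>l=1..Suc n. \<Sum>m\<in>UNIV. join_rate S m (Suc n) * (D m l * y (Suc l) + (1 - D m l) * y l)) =
     (\<Sum>m\<in>UNIV. join_rate S m (Suc n) * (\<Sum>l=1..Suc n. D m l * y (Suc l) + (1 - D m l) * y l))"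
    by (subst sum.swap) (simp only: sum_distrib_left)
  also have "\<dots> = total_join_rate S (Suc n) * total_wait S (Suc (Suc n)) - waiting_flow S (Suc n)"
    by (simp only: ins) (simp add: total_join_rate_def waiting_flow_def algebra_simps sum_subtractf sum_distrib_left)
  finally show ?thesis
    unfolding zsum by (simp add: \<gamma>_def marginal_wait_def algebra_simps)
qed

text \<open>Little's law for the queue lengths below \<open>n\<close>, with the remainder at \<open>n\<close>. It is a consequence of
  the recursion alone; minimality of the waiting times is not used.\<close>

lemma little_partial_sum:
  fixes G :: "('m::finite) model"
  assumes ss: "steady_state G S" and vl: "valid_lotteries S" and mw: "mean_wait S"
    and mu: "pax_rate G > 0" and a: "\<And>k. 0 \<le> total_join_rate S k"
    and front: "\<And>k. Suc k < n \<Longrightarrow> wait_eq_front G S k"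
    and behind: "\<And>k l. Suc k < n \<Longrightarrow> 1 \<le> k \<Longrightarrow> 2 \<le> l \<Longrightarrow> l \<le> k + 1 \<Longrightarrow> wait_eq_behind G S k l"
  shows "(\<Sum>k<n. prob S k * waiting_flow S k) =
    (\<Sum>k<n. prob S k * real k) + pax_rate G * prob S n * marginal_wait S n"
proof -
  have d0: "marginal_wait S 0 = 0" by (simp add: marginal_wait_def)
  have "waiting_flow S k - total_join_rate S k * marginal_wait S (Suc k) + pax_rate G * marginal_wait S k = real k"
    if "k < n" for k
  proof (cases k)
    case 0
    then show ?thesis using waiting_flow_0[OF vl mw] d0 by simp
  next
    case (Suc j)
    show ?thesis unfolding Suc
      by (subst waiting_flow_Suc[OF vl mw mu a]) (use that Suc front behind in auto)
  qed
  then show ?thesis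
    by (subst balanced_sum[where P = "prob S" and a = "total_join_rate S" and \<mu> = "pax_rate G" and u = "marginal_wait S", OF steady_state_balance[OF ss mu] d0])
      simp
qed

section \<open>The welfare of an admission policy\<close>

text \<open>The welfare gained by admitting a group-\<open>m\<close> driver, apart from the cost of waiting.\<close>

definition admission_margin :: "'m model \<Rightarrow> 'm \<Rightarrow> real" where
  "admission_margin G m = order_utility G m - (outside_utility G + outside_profit G) * trip_time G"

text \<open>The welfare lost per unit of time for each driver in queue.\<close>

definition holding_cost :: "'m model \<Rightarrow> real" where
  "holding_cost G = outside_utility G + outside_profit G"

text \<open>The largest surplus rate when every admission is charged the shadow price \<open>v\<close>: exactly the
  groups whose margin exceeds \<open>v\<close> are worth admitting.\<close>

definition admission_surplus :: "('m::finite) model \<Rightarrow> real \<Rightarrow> real" where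
  "admission_surplus G v = (\<Sum>m\<in>UNIV. drv_rate G m * max 0 (admission_margin G m - v))"

text \<open>The rate at which admission margins are earned at queue length \<open>k\<close>.\<close>

definition margin_flow :: "('m::finite) model \<Rightarrow> 'm plan \<Rightarrow> nat \<Rightarrow> real" where
  "margin_flow G S k = (\<Sum>m\<in>UNIV. join_rate S m k * admission_margin G m)"

lemma social_gain_flow:
  "(\<Sum>m\<in>UNIV. join_rate S m k * social_gain G S m k) =
    margin_flow G S k - holding_cost G * waiting_flow S k"
proof -
  have "join_rate S m k * social_gain G S m k =
      join_rate S m k * admission_margin G m - holding_cost G * (join_rate S m k * wait S m k)" for m
    by (simp add: social_gain_def admission_margin_def holding_cost_def algebra_simps)
  then show ?thesis
    by (simp add: margin_flow_def waiting_flow_def sum_subtractf sum_distrib_left)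
qed

lemma margin_flow_le:
  fixes G :: "('m::finite) model"
  assumes "\<And>m. 0 \<le> join_rate S m k" "\<And>m. join_rate S m k \<le> drv_rate G m"
  shows "margin_flow G S k - total_join_rate S k * v \<le> admission_surplus G v"
proof -
  have "margin_flow G S k - total_join_rate S k * v =
      (\<Sum>m\<in>UNIV. join_rate S m k * (admission_margin G m - v))"
    by (simp add: margin_flow_def total_join_rate_def sum_distrib_right right_diff_distrib sum_subtractf)
  also have "\<dots> \<le> admission_surplus G v"
    unfolding admission_surplus_def
    by (intro sum_mono) (meson assms max.cobounded1 max.cobounded2 mult_left_mono mult_right_mono order_trans)
  finally show ?thesis .
qed

text \<open>The verification step: the optimality inequality for \<open>u\<close> bounds the welfare accumulated at queue
  lengths below \<open>n\<close>, up to a boundary term.\<close>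

lemma welfare_partial_sum_le:
  fixes G :: "('m::finite) model"
  assumes ss: "steady_state G S" and mu: "pax_rate G > 0"
    and j: "\<And>m k. 0 \<le> join_rate S m k" "\<And>m k. join_rate S m k \<le> drv_rate G m"
    and u0: "u 0 = 0"
    and bell: "\<And>k. admission_surplus G (u (Suc k)) \<le> g + holding_cost G * real k - pax_rate G * u k"
  shows "(\<Sum>k<n. prob S k * (margin_flow G S k - holding_cost G * real k)) \<le>
    g * (\<Sum>k<n. prob S k) + pax_rate G * prob S n * u n"
proof -
  have a: "0 \<le> total_join_rate S k" for k
    unfolding total_join_rate_def by (intro sum_nonneg j)
  have "(\<Sum>k<n. prob S k * (margin_flow G S k - holding_cost G * real k
      - total_join_rate S k * u (Suc k) + pax_rate G * u k)) \<le> (\<Sum>k<n. prob S k * g)"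
  proof (intro sum_mono mult_left_mono steady_state_prob(2)[OF ss mu a])
    fix k
    show "margin_flow G S k - holding_cost G * real k - total_join_rate S k * u (Suc k) + pax_rate G * u k \<le> g"
      using margin_flow_le[of S k G "u (Suc k)"] j bell[of k] by fastforce
  qed
  then show ?thesis
    by (subst balanced_sum[where P = "prob S" and a = "total_join_rate S" and \<mu> = "pax_rate G" and u = u, OF steady_state_balance[OF ss mu] u0])
      (simp add: sum_distrib_left mult.commute)
qed

lemma lower_objective_flow:
  fixes G :: "('m::finite) model"
  assumes "threshold_joining G N S" "\<And>m. N m \<le> n"
  shows "lower_objective G N S =
    (\<Sum>k<n. prob S k * (margin_flow G S k - holding_cost G * waiting_flow S k))"
proof -
  have "lower_objective G N S = (\<Sum>m\<in>UNIV. \<Sum>k<n. prob S k * (join_rate S m k * social_gain G S m k))"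
    unfolding lower_objective_def sum_distrib_left
  proof (rule sum.cong[OF refl])
    fix m
    have "(\<Sum>k<n. prob S k * (join_rate S m k * social_gain G S m k)) =
        (\<Sum>k<N m. prob S k * (join_rate S m k * social_gain G S m k))"
      by (rule sum.mono_neutral_right) (use assms in \<open>auto simp: threshold_joining_def\<close>)
    also have "\<dots> = (\<Sum>k<N m. drv_rate G m * (prob S k * social_gain G S m k))"
      by (rule sum.cong) (use assms in \<open>auto simp: threshold_joining_def\<close>)
    finally show "(\<Sum>k<N m. drv_rate G m * (prob S k * social_gain G S m k)) =
        (\<Sum>k<n. prob S k * (join_rate S m k * social_gain G S m k))" ..
  qed
  then show ?thesis
    by (subst (asm) sum.swap) (simp only: sum_distrib_left[symmetric] social_gain_flow)
qed

lemma max_capacity_ge: "N m \<le> max_capacity N"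
  by (simp add: max_capacity_def)

lemma threshold_join_bounds:
  fixes G :: "('m::finite) model"
  assumes adm: "admissible_model G" and "threshold_joining G N S"
  shows "0 \<le> join_rate S m k" and "join_rate S m k \<le> drv_rate G m"
    and "0 \<le> total_join_rate S k"
  using assms by (auto simp: threshold_joining_def admissible_model_def total_join_rate_def
      of_bool_def less_imp_le intro!: sum_nonneg)

lemma threshold_flows_zero:
  fixes G :: "('m::finite) model"
  assumes "threshold_joining G N S" "max_capacity N \<le> k"
  shows "total_join_rate S k = 0" and "margin_flow G S k = 0"
proof -
  have "join_rate S m k = 0" for m
    using assms max_capacity_ge[of N m] by (simp add: threshold_joining_def)
  then show "total_join_rate S k = 0" "margin_flow G S k = 0"
    by (simp_all add: total_join_rate_def margin_flow_def)
qed

lemma threshold_prob: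
  fixes G :: "('m::finite) model"
  assumes adm: "admissible_model G" and th: "threshold_joining G N S" and ss: "steady_state G S"
  shows "max_capacity N < k \<Longrightarrow> prob S k = 0"
    and "max_capacity N \<le> n \<Longrightarrow> (\<Sum>k\<le>n. prob S k) = 1"
proof -
  have mu: "pax_rate G > 0" using adm by (simp add: admissible_model_def)
  have a: "0 \<le> total_join_rate S k" for k by (rule threshold_join_bounds(3)[OF adm th])
  show zero: "prob S k = 0" if c: "max_capacity N < k" for k
  proof -
    obtain j where j: "k = Suc j" using c by (cases k) simp_all
    show ?thesis
      using steady_state_balance[OF ss mu, of j] threshold_flows_zero(1)[OF th, of j] c mu j by simp
  qed
  show "(\<Sum>k\<le>n. prob S k) = 1" if "max_capacity N \<le> n"
  proof -
    have "prob S sums (\<Sum>k\<le>n. prob S k)"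
      by (rule sums_finite) (use zero that in auto)
    then show ?thesis using steady_state_prob(3)[OF ss mu a] sums_unique2 by blast
  qed
qed

text \<open>Little's law for the truncated system: all plans that are feasible for the same capacities
  have the same objective value. The upper summation limit may exceed the largest capacity because
  longer queues have probability 0.\<close>

lemma lower_objective_eq:
  fixes G :: "('m::finite) model"
  assumes adm: "admissible_model G" and lf: "lower_feasible G N S" and n: "max_capacity N \<le> n"
  shows "lower_objective G N S =
    (\<Sum>k\<le>n. prob S k * (margin_flow G S k - holding_cost G * real k))"
proof -
  let ?c = "max_capacity N"
  have mu: "pax_rate G > 0" using adm by (simp add: admissible_model_def)
  have vl: "valid_lotteries S" and mw: "mean_wait S" and ss: "steady_state G S"
    and th: "threshold_joining G N S" and tw: "truncated_wait_equations G N S"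
    using lf by (auto simp: lower_feasible_def)
  have a: "0 \<le> total_join_rate S k" for k by (rule threshold_join_bounds(3)[OF adm th])
  \<comment> \<open>The boundary equations of the truncated system make the remainder in Little's law equal to the
    missing term \<open>c * P c\<close>, where \<open>c\<close> is the largest capacity.\<close>
  have top: "pax_rate G * marginal_wait S ?c = real ?c"
  proof (cases ?c)
    case 0
    then show ?thesis by (simp add: marginal_wait_def)
  next
    case (Suc c)
    have one: "pos_wait S c 1 = 1 / pax_rate G"
      using tw Suc by (simp add: truncated_wait_equations_def)
    have more: "pos_wait S c (Suc l) = 1 / pax_rate G + pos_wait S (c - 1) l"
      if "l \<in> {1..c}" for l
    proof -
      from tw have "2 \<le> Suc l \<and> Suc l \<le> ?c \<longrightarrow>
        pos_wait S (?c - 1) (Suc l) = 1 / pax_rate G + pos_wait S (?c - 2) (Suc l - 1)"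
        unfolding truncated_wait_equations_def by blast
      then show ?thesis using that Suc by (simp add: numeral_2_eq_2)
    qed
    have "total_wait S (Suc c) = pos_wait S c 1 + (\<Sum>l=Suc 1..Suc c. pos_wait S c l)"
      unfolding total_wait_def diff_Suc_1 by (rule sum.atLeast_Suc_atMost) simp
    also have "(\<Sum>l=Suc 1..Suc c. pos_wait S c l) = (\<Sum>l=1..c. pos_wait S c (Suc l))"
      by (rule sum.shift_bounds_cl_Suc_ivl)
    also have "\<dots> = (\<Sum>l=1..c. 1 / pax_rate G + pos_wait S (c - 1) l)"
      by (intro sum.cong more refl)
    also have "\<dots> = real c / pax_rate G + total_wait S c"
      by (simp add: sum.distrib total_wait_def)
    finally show ?thesis using Suc one mu by (simp add: marginal_wait_def field_simps)
  qed
  have little: "(\<Sum>k<?c. prob S k * waiting_flow S k) = (\<Sum>k\<le>?c. prob S k * real k)"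
  proof -
    have "(\<Sum>k<?c. prob S k * waiting_flow S k) =
        (\<Sum>k<?c. prob S k * real k) + pax_rate G * prob S ?c * marginal_wait S ?c"
      by (rule little_partial_sum[OF ss vl mw mu a])
        (use tw in \<open>auto simp: truncated_wait_equations_def\<close>)
    also have "pax_rate G * prob S ?c * marginal_wait S ?c = prob S ?c * real ?c"
      using top by (metis mult.commute mult.left_commute)
    finally show ?thesis by (simp add: lessThan_Suc_atMost[symmetric])
  qed
  have "lower_objective G N S =
      (\<Sum>k<?c. prob S k * (margin_flow G S k - holding_cost G * waiting_flow S k))"
    by (rule lower_objective_flow[OF th max_capacity_ge])
  also have "\<dots> = (\<Sum>k<?c. prob S k * margin_flow G S k) - holding_cost G * (\<Sum>k<?c. prob S k * waiting_flow S k)"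
    by (simp add: sum_distrib_left sum_subtractf[symmetric] algebra_simps)
  also have "(\<Sum>k<?c. prob S k * margin_flow G S k) = (\<Sum>k\<le>?c. prob S k * margin_flow G S k)"
    using threshold_flows_zero(2)[OF th, of ?c] by (simp add: lessThan_Suc_atMost[symmetric])
  also have "\<dots> - holding_cost G * (\<Sum>k<?c. prob S k * waiting_flow S k) =
      (\<Sum>k\<le>?c. prob S k * (margin_flow G S k - holding_cost G * real k))"
    unfolding little by (simp add: sum_distrib_left sum_subtractf[symmetric] algebra_simps)
  also have "\<dots> = (\<Sum>k\<le>n. prob S k * (margin_flow G S k - holding_cost G * real k))"
    by (rule sum.mono_neutral_left) (use n threshold_prob(1)[OF adm th ss] in auto)
  finally show ?thesis .
qed

section \<open>Upper bounds from the optimality inequality\<close>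

lemma lower_objective_le:
  fixes G :: "('m::finite) model"
  assumes adm: "admissible_model G" and lf: "lower_feasible G N S" and u0: "u 0 = 0"
    and bell: "\<And>k. admission_surplus G (u (Suc k)) \<le> g + holding_cost G * real k - pax_rate G * u k"
  shows "lower_objective G N S \<le> g"
proof -
  let ?n = "max_capacity N"
  have mu: "pax_rate G > 0" using adm by (simp add: admissible_model_def)
  have ss: "steady_state G S" and th: "threshold_joining G N S"
    using lf by (auto simp: lower_feasible_def)
  have "(\<Sum>k<Suc ?n. prob S k * (margin_flow G S k - holding_cost G * real k)) \<le>
      g * (\<Sum>k<Suc ?n. prob S k) + pax_rate G * prob S (Suc ?n) * u (Suc ?n)"
    by (rule welfare_partial_sum_le[OF ss mu _ _ u0 bell]) (rule threshold_join_bounds[OF adm th])+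
  then show ?thesis
    using lower_objective_eq[OF adm lf order_refl] threshold_prob[OF adm th ss]
    by (simp add: lessThan_Suc_atMost)
qed

lemma sw_feasible_bounds:
  fixes G :: "('m::finite) model"
  assumes adm: "admissible_model G" and f: "sw_feasible G S"
  shows "0 \<le> join_rate S m k" and "join_rate S m k \<le> drv_rate G m"
    and "0 \<le> total_join_rate S k" and "0 \<le> total_wait S k" and "0 \<le> wait S m k"
proof -
  show "0 \<le> join_rate S m k" and "join_rate S m k \<le> drv_rate G m" for m k
    using assms by (auto simp: sw_feasible_def rational_joining_def admissible_model_def less_imp_le)
  then show "0 \<le> total_join_rate S k" by (simp add: total_join_rate_def sum_nonneg)
  have pw: "0 \<le> pos_wait S n l" if "l \<in> {1..n+1}" for n l
    using f that by (auto simp: sw_feasible_def expected_pos_wait_def nonneg_pos_wait_def)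
  then show "0 \<le> total_wait S k" by (auto simp: total_wait_def intro!: sum_nonneg)
  have "wait S m k = (\<Sum>l=1..k+1. lottery S m k l * pos_wait S k l)"
    using f by (simp add: sw_feasible_def mean_wait_def)
  also have "\<dots> \<ge> 0"
    using f pw by (intro sum_nonneg mult_nonneg_nonneg) (auto simp: sw_feasible_def valid_lotteries_def)
  finally show "0 \<le> wait S m k" .
qed

text \<open>Drivers join only while their waiting time is below a bound given by the fee, so the gains
  that enter the objective are bounded.\<close>

lemma sw_objective_summable:
  fixes G :: "('m::finite) model"
  assumes adm: "admissible_model G" and f: "sw_feasible G S"
  shows "summable (\<lambda>n. prob S n * (\<Sum>m\<in>UNIV. join_rate S m n * social_gain G S m n))"
proof -
  have mu: "pax_rate G > 0" and r: "outside_utility G > 0" and nu: "outside_profit G > 0"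
    and T: "trip_time G > 0" and lam: "\<And>m. 0 < drv_rate G m"
    using adm by (auto simp: admissible_model_def)
  have ss: "steady_state G S" using f by (simp add: sw_feasible_def)
  have Pn: "0 \<le> prob S n" for n
    by (rule steady_state_prob(2)[OF ss mu sw_feasible_bounds(3)[OF adm f]])
  have Ps: "summable (prob S)"
    using steady_state_prob(3)[OF ss mu sw_feasible_bounds(3)[OF adm f]] by (rule sums_summable)
  define C where "C m = \<bar>order_utility G m\<bar> + (outside_utility G + outside_profit G) *
      \<bar>(order_utility G m - fee S m) / outside_utility G\<bar>" for m
  have bound: "\<bar>join_rate S m n * social_gain G S m n\<bar> \<le> drv_rate G m * C m" for m n
  proof (cases "net_utility G S m n \<ge> 0")
    case True
    then have "trip_time G + wait S m n \<le> (order_utility G m - fee S m) / outside_utility G"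
      using r by (simp add: net_utility_def field_simps)
    moreover have "0 \<le> trip_time G + wait S m n"
      using T sw_feasible_bounds(5)[OF adm f, of m n] by simp
    ultimately have "\<bar>trip_time G + wait S m n\<bar> \<le> \<bar>(order_utility G m - fee S m) / outside_utility G\<bar>"
      by linarith
    then have "(outside_utility G + outside_profit G) * \<bar>trip_time G + wait S m n\<bar> \<le>
        (outside_utility G + outside_profit G) * \<bar>(order_utility G m - fee S m) / outside_utility G\<bar>"
      using r nu by (intro mult_left_mono) auto
    moreover have "\<bar>social_gain G S m n\<bar> \<le> \<bar>order_utility G m\<bar> +
        (outside_utility G + outside_profit G) * \<bar>trip_time G + wait S m n\<bar>"
      unfolding social_gain_def using r nu abs_triangle_ineq4 by (metis abs_mult abs_of_pos add_pos_pos)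
    ultimately have "\<bar>social_gain G S m n\<bar> \<le> C m" by (simp add: C_def)
    then show ?thesis
      using sw_feasible_bounds(1,2)[OF adm f, of m n] lam[of m]
      by (auto simp: abs_mult intro!: mult_mono)
  next
    case False
    then have "join_rate S m n = 0" using f by (simp add: sw_feasible_def rational_joining_def)
    moreover have "0 \<le> C m" using r nu by (simp add: C_def)
    ultimately show ?thesis using lam[of m] by simp
  qed
  show ?thesis
  proof (rule summable_comparison_test')
    show "summable (\<lambda>n. prob S n * (\<Sum>m\<in>UNIV. drv_rate G m * C m))"
      by (rule summable_mult2[OF Ps])
    show "norm (prob S n * (\<Sum>m\<in>UNIV. join_rate S m n * social_gain G S m n)) \<le>
        prob S n * (\<Sum>m\<in>UNIV. drv_rate G m * C m)" if "n \<ge> 0" for n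
    proof -
      have "\<bar>\<Sum>m\<in>UNIV. join_rate S m n * social_gain G S m n\<bar> \<le> (\<Sum>m\<in>UNIV. drv_rate G m * C m)"
        by (rule order_trans[OF sum_abs]) (intro sum_mono bound)
      then show ?thesis using Pn[of n] by (simp add: abs_mult mult_left_mono)
    qed
  qed
qed

text \<open>If the welfare exceeded \<open>g\<close>, the partial sums would exceed their bound by a fixed amount from
  some queue length on. The only term that can absorb this is the remainder in Little's law, so
  \<open>marginal_wait\<close> would stay below a negative constant and \<open>total_wait\<close> would become negative.\<close>

lemma sw_objective_le:
  fixes G :: "('m::finite) model"
  assumes adm: "admissible_model G" and f: "sw_feasible G S" and u0: "u 0 = 0"
    and bell: "\<And>k. admission_surplus G (u (Suc k)) \<le> g + holding_cost G * real k - pax_rate G * u k"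
    and uB: "\<And>k. u k \<le> B"
  shows "sw_objective G S \<le> g"
proof (rule ccontr)
  assume neg: "\<not> ?thesis"
  define J where "J = sw_objective G S"
  define \<epsilon> where "\<epsilon> = (J - g) / 2"
  have \<epsilon>: "\<epsilon> > 0" using neg by (simp add: \<epsilon>_def J_def)
  define h where "h = holding_cost G"
  define \<mu> where "\<mu> = pax_rate G"
  have mu: "\<mu> > 0" and h: "h > 0"
    using adm by (auto simp: admissible_model_def \<mu>_def h_def holding_cost_def)
  have ss: "steady_state G S" and vl: "valid_lotteries S" and mw: "mean_wait S"
    and we: "wait_equations G S"
    using f by (auto simp: sw_feasible_def expected_pos_wait_def)
  have a: "0 \<le> total_join_rate S k" for k by (rule sw_feasible_bounds(3)[OF adm f])
  have P: "prob S sums 1" and Pn: "\<And>k. 0 \<le> prob S k"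
    using steady_state_prob(2,3)[OF ss mu[unfolded \<mu>_def] a] by auto
  have P1: "prob S n \<le> 1" for n
    using sum_le_suminf[OF sums_summable[OF P], of "{n}"] Pn sums_unique[OF P] by simp
  have part: "(\<Sum>k<n. prob S k * (\<Sum>m\<in>UNIV. join_rate S m k * social_gain G S m k)) \<le>
      g * (\<Sum>k<n. prob S k) + \<mu> * prob S n * B - h * \<mu> * prob S n * marginal_wait S n" for n
  proof -
    have L: "(\<Sum>k<n. prob S k * waiting_flow S k) =
        (\<Sum>k<n. prob S k * real k) + \<mu> * prob S n * marginal_wait S n"
      unfolding \<mu>_def by (rule little_partial_sum[OF ss vl mw mu[unfolded \<mu>_def] a])
        (use we in \<open>auto simp: wait_equations_def\<close>)
    have "(\<Sum>k<n. prob S k * (\<Sum>m\<in>UNIV. join_rate S m k * social_gain G S m k)) =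
        (\<Sum>k<n. prob S k * margin_flow G S k) - h * (\<Sum>k<n. prob S k * waiting_flow S k)"
      unfolding social_gain_flow h_def by (simp add: sum_distrib_left sum_subtractf[symmetric] algebra_simps)
    also have "\<dots> = (\<Sum>k<n. prob S k * (margin_flow G S k - h * real k)) - h * (\<mu> * prob S n * marginal_wait S n)"
      unfolding L by (simp add: sum_distrib_left sum_subtractf[symmetric] algebra_simps)
    also have "(\<Sum>k<n. prob S k * (margin_flow G S k - h * real k)) \<le> g * (\<Sum>k<n. prob S k) + \<mu> * prob S n * u n"
      unfolding \<mu>_def h_def
      by (rule welfare_partial_sum_le[OF ss mu[unfolded \<mu>_def] sw_feasible_bounds(1,2)[OF adm f] u0 bell])
    also have "\<mu> * prob S n * u n \<le> \<mu> * prob S n * B"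
      using mu Pn[of n] uB[of n] by (intro mult_left_mono) auto
    finally show ?thesis by (simp add: mult.assoc)
  qed
  have "(\<lambda>n. \<Sum>k<n. prob S k * (\<Sum>m\<in>UNIV. join_rate S m k * social_gain G S m k)) \<longlonglongrightarrow> J"
    unfolding J_def sw_objective_def by (rule summable_LIMSEQ[OF sw_objective_summable[OF adm f]])
  moreover have "(\<lambda>n. g * (\<Sum>k<n. prob S k) + \<mu> * prob S n * B) \<longlonglongrightarrow> g * 1 + \<mu> * 0 * B"
    by (intro tendsto_intros summable_LIMSEQ_zero[OF sums_summable[OF P]])
      (use P in \<open>simp add: sums_def\<close>)
  ultimately have "(\<lambda>n. (\<Sum>k<n. prob S k * (\<Sum>m\<in>UNIV. join_rate S m k * social_gain G S m k)) -
      (g * (\<Sum>k<n. prob S k) + \<mu> * prob S n * B)) \<longlonglongrightarrow> J - (g * 1 + \<mu> * 0 * B)"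
    by (rule tendsto_diff)
  moreover have "J - (g * 1 + \<mu> * 0 * B) > \<epsilon>" using neg by (simp add: \<epsilon>_def J_def)
  ultimately have "\<forall>\<^sub>F n in sequentially. \<epsilon> < (\<Sum>k<n. prob S k * (\<Sum>m\<in>UNIV. join_rate S m k * social_gain G S m k)) -
      (g * (\<Sum>k<n. prob S k) + \<mu> * prob S n * B)"
    by (rule order_tendstoD)
  then obtain n0 where n0: "\<And>n. n \<ge> n0 \<Longrightarrow> \<epsilon> < (\<Sum>k<n. prob S k * (\<Sum>m\<in>UNIV. join_rate S m k * social_gain G S m k)) -
      (g * (\<Sum>k<n. prob S k) + \<mu> * prob S n * B)"
    by (auto simp: eventually_sequentially)
  define \<eta> where "\<eta> = \<epsilon> / (h * \<mu>)"
  have \<eta>: "\<eta> > 0" using \<epsilon> h mu by (simp add: \<eta>_def)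
  have drop: "marginal_wait S n \<le> - \<eta>" if "n \<ge> n0" for n
  proof -
    have "\<epsilon> \<le> h * \<mu> * (prob S n * (- marginal_wait S n))"
      using n0[OF that] part[of n] by (simp add: algebra_simps)
    then have 1: "\<eta> \<le> prob S n * (- marginal_wait S n)"
      using h mu by (simp add: \<eta>_def field_simps)
    then have "0 \<le> - marginal_wait S n"
      using \<eta> Pn[of n] by (smt (verit, best) mult_nonneg_nonpos)
    then have "prob S n * (- marginal_wait S n) \<le> 1 * (- marginal_wait S n)"
      using P1[of n] by (intro mult_right_mono) auto
    with 1 show ?thesis by simp
  qed
  have lin: "total_wait S (n0 + i) \<le> total_wait S n0 - \<eta> * real i" for i
  proof (induction i)
    case (Suc i)
    then show ?case using drop[of "n0 + Suc i"] by (simp add: marginal_wait_def algebra_simps)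
  qed simp
  obtain i :: nat where "total_wait S n0 / \<eta> < real i" using reals_Archimedean2 by blast
  then have "total_wait S n0 - \<eta> * real i < 0" using \<eta> by (simp add: field_simps)
  then show False using lin[of i] sw_feasible_bounds(4)[OF adm f, of "n0 + i"] by simp
qed

section \<open>Realizing thresholds by first come, first served\<close>

text \<open>Every driver enters at the last position \<open>n + 1\<close>, and hence waits \<open>(n + 1) / \<mu>\<close>. The fee leaves
  group \<open>m\<close> no utility when it joins at queue length \<open>N m - 1\<close>. The function \<open>q\<close> is the
  unnormalized steady state.\<close>

definition fcfs_plan :: "('m::finite) model \<Rightarrow> ('m \<Rightarrow> nat) \<Rightarrow> 'm plan" where
  "fcfs_plan G N = (let q = (\<lambda>n. \<Prod>j=1..n. (\<Sum>m\<in>UNIV. drv_rate G m * of_bool (j - 1 < N m)) / pax_rate G) in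
    \<lparr> fee = (\<lambda>m. order_utility G m - outside_utility G * (trip_time G + real (N m) / pax_rate G)),
      lottery = (\<lambda>m n l. of_bool (l = n + 1)),
      join_rate = (\<lambda>m n. drv_rate G m * of_bool (n < N m)),
      wait = (\<lambda>m n. real (n + 1) / pax_rate G),
      pos_wait = (\<lambda>n l. real l / pax_rate G),
      prob = (\<lambda>n. inverse (1 + (\<Sum>i. q (Suc i))) * q n) \<rparr>)"

lemma fcfs_simps [simp]:
  "fee (fcfs_plan G N) m = order_utility G m - outside_utility G * (trip_time G + real (N m) / pax_rate G)"
  "lottery (fcfs_plan G N) m n l = of_bool (l = n + 1)"
  "join_rate (fcfs_plan G N) m n = drv_rate G m * of_bool (n < N m)"
  "wait (fcfs_plan G N) m n = real (n + 1) / pax_rate G"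
  "pos_wait (fcfs_plan G N) n l = real l / pax_rate G"
  by (simp_all add: fcfs_plan_def Let_def)

lemma fcfs_threshold: "threshold_joining G N (fcfs_plan G N)"
  by (simp add: threshold_joining_def)

lemma fcfs_lotteries: "valid_lotteries (fcfs_plan G N)" "mean_wait (fcfs_plan G N)"
  by (auto simp: valid_lotteries_def mean_wait_def of_bool_def if_distrib if_distribR cong: if_cong)

lemma fcfs_steady_state:
  fixes G :: "('m::finite) model"
  shows "steady_state G (fcfs_plan G N)"
proof -
  let ?S = "fcfs_plan G N"
  let ?q = "\<lambda>n. \<Prod>j=1..n. total_join_rate ?S (j - 1) / pax_rate G"
  have P: "prob ?S n = inverse (1 + (\<Sum>i. ?q (Suc i))) * ?q n" for n
    by (simp add: fcfs_plan_def Let_def total_join_rate_def)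
  have "summable (\<lambda>i. ?q (Suc i))"
  proof (rule summable_finite[of "{..<max_capacity N}"])
    fix i assume "i \<notin> {..<max_capacity N}"
    then have "total_join_rate ?S (Suc i - 1) = 0"
      by (intro threshold_flows_zero(1)[OF fcfs_threshold]) simp
    then show "?q (Suc i) = 0" by simp
  qed simp
  then show ?thesis unfolding steady_state_def P by simp
qed

lemma fcfs_net_utility:
  assumes "admissible_model G"
  shows "net_utility G (fcfs_plan G N) m n \<ge> 0 \<longleftrightarrow> n < N m"
proof -
  define c where "c = outside_utility G / pax_rate G"
  have "net_utility G (fcfs_plan G N) m n = c * (real (N m) - real (n + 1))"
    by (simp add: net_utility_def c_def algebra_simps diff_divide_distrib add_divide_distrib)
  moreover have "c > 0"
    using assms by (simp add: admissible_model_def c_def)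
  ultimately show ?thesis by (auto simp: zero_le_mult_iff)
qed

text \<open>Multiplying a waiting-time equation by the total event rate \<open>\<gamma>\<close> clears its denominators; under
  the equations below, \<open>(a + b) / \<gamma> = 1\<close>.\<close>

lemma uniformized_eq:
  fixes \<gamma> :: real
  assumes "\<gamma> > 0"
  shows "x = a / \<gamma> * (1 / \<gamma> + y) + b / \<gamma> * (1 / \<gamma> + z) \<longleftrightarrow> \<gamma> * x = (a + b) / \<gamma> + a * y + b * z"
proof -
  have "\<gamma> * (a / \<gamma> * (1 / \<gamma> + y) + b / \<gamma> * (1 / \<gamma> + z)) = (a + b) / \<gamma> + a * y + b * z"
    using assms by (simp add: distrib_left add_divide_distrib)
  then show ?thesis using assms by (metis mult_cancel_left less_irrefl)
qed

lemma fcfs_eq_behind: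
  fixes G :: "('m::finite) model" and w :: "nat \<Rightarrow> nat \<Rightarrow> real"
  assumes adm: "admissible_model G" and l: "l \<le> n + 1"
  shows "wait_eq_behind G (fcfs_plan G N\<lparr>pos_wait := w\<rparr>) n l \<longleftrightarrow>
    (total_join_rate (fcfs_plan G N) (n+1) + pax_rate G) * w n l =
      1 + total_join_rate (fcfs_plan G N) (n+1) * w (n+1) l + pax_rate G * w (n-1) (l-1)"
proof -
  define \<gamma> where "\<gamma> = total_join_rate (fcfs_plan G N) (n+1) + pax_rate G"
  have g: "\<gamma> > 0"
    using adm threshold_join_bounds(3)[OF adm fcfs_threshold]
    unfolding \<gamma>_def by (simp add: admissible_model_def add_nonneg_pos)
  let ?S = "fcfs_plan G N\<lparr>pos_wait := w\<rparr>"
  have tj: "total_join_rate ?S k = total_join_rate (fcfs_plan G N) k" for k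
    by (simp add: total_join_rate_def)
  have D: "(\<Sum>i=1..l. lottery ?S m (n+1) i) = 0" for m
    using l by (intro sum.neutral) auto
  have J: "(\<Sum>m\<in>UNIV. join_rate ?S m (n+1) / \<gamma> * c) = total_join_rate (fcfs_plan G N) (n+1) / \<gamma> * c" for c
    unfolding tj[symmetric] by (simp only: total_join_rate_def sum_distrib_right sum_divide_distrib)
  have "wait_eq_behind G ?S n l \<longleftrightarrow>
    w n l = total_join_rate (fcfs_plan G N) (n+1) / \<gamma> * (1/\<gamma> + w (n+1) l) + pax_rate G / \<gamma> * (1/\<gamma> + w (n-1) (l-1))"
    unfolding wait_eq_behind_def Let_def tj \<gamma>_def[symmetric] D
    by (simp only: J mult_zero_left add_0_right diff_zero mult_1) simp
  also have "\<dots> \<longleftrightarrow> \<gamma> * w n l = (total_join_rate (fcfs_plan G N) (n+1) + pax_rate G) / \<gamma> +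
      total_join_rate (fcfs_plan G N) (n+1) * w (n+1) l + pax_rate G * w (n-1) (l-1)"
    by (rule uniformized_eq[OF g])
  finally show ?thesis using g by (simp add: \<gamma>_def)
qed

lemma fcfs_eq_front:
  fixes G :: "('m::finite) model" and w :: "nat \<Rightarrow> nat \<Rightarrow> real"
  assumes adm: "admissible_model G"
  shows "wait_eq_front G (fcfs_plan G N\<lparr>pos_wait := w\<rparr>) n \<longleftrightarrow>
    (total_join_rate (fcfs_plan G N) (n+1) + pax_rate G) * w n 1 =
      1 + total_join_rate (fcfs_plan G N) (n+1) * w (n+1) 1"
proof -
  define \<gamma> where "\<gamma> = total_join_rate (fcfs_plan G N) (n+1) + pax_rate G"
  have g: "\<gamma> > 0"
    using adm threshold_join_bounds(3)[OF adm fcfs_threshold]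
    unfolding \<gamma>_def by (simp add: admissible_model_def add_nonneg_pos)
  let ?S = "fcfs_plan G N\<lparr>pos_wait := w\<rparr>"
  have tj: "total_join_rate ?S k = total_join_rate (fcfs_plan G N) k" for k
    by (simp add: total_join_rate_def)
  have D: "lottery ?S m (n+1) 1 = 0" for m by simp
  have J: "(\<Sum>m\<in>UNIV. join_rate ?S m (n+1) / \<gamma> * c) = total_join_rate (fcfs_plan G N) (n+1) / \<gamma> * c" for c
    unfolding tj[symmetric] by (simp only: total_join_rate_def sum_distrib_right sum_divide_distrib)
  have "wait_eq_front G ?S n \<longleftrightarrow>
    w n 1 = total_join_rate (fcfs_plan G N) (n+1) / \<gamma> * (1/\<gamma> + w (n+1) 1) + pax_rate G / \<gamma> * (1/\<gamma>)"
    unfolding wait_eq_front_def Let_def tj \<gamma>_def[symmetric] D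
    by (simp only: J mult_zero_left add_0_right diff_zero mult_1) simp
  also have "\<dots> \<longleftrightarrow> \<gamma> * w n 1 = (total_join_rate (fcfs_plan G N) (n+1) + pax_rate G) / \<gamma> +
      total_join_rate (fcfs_plan G N) (n+1) * w (n+1) 1"
    using uniformized_eq[OF g, where z = 0] by simp
  finally show ?thesis using g by (simp add: \<gamma>_def)
qed

lemma fcfs_wait_equations:
  fixes G :: "('m::finite) model"
  assumes adm: "admissible_model G"
  shows "1 \<le> l \<Longrightarrow> l \<le> n + 1 \<Longrightarrow> wait_eq_behind G (fcfs_plan G N) n l"
    and "wait_eq_front G (fcfs_plan G N) n"
proof -
  have mu: "pax_rate G > 0" using adm by (simp add: admissible_model_def)
  have upd: "fcfs_plan G N\<lparr>pos_wait := \<lambda>n l. real l / pax_rate G\<rparr> = fcfs_plan G N"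
    by (simp add: fcfs_plan_def Let_def)
  show "wait_eq_behind G (fcfs_plan G N) n l" if "1 \<le> l" "l \<le> n + 1"
    using fcfs_eq_behind[OF adm that(2), where N = N and w = "\<lambda>n l. real l / pax_rate G", unfolded upd] mu that(1)
    by (simp add: field_simps of_nat_diff)
  show "wait_eq_front G (fcfs_plan G N) n"
    using fcfs_eq_front[OF adm, where N = N and w = "\<lambda>n l. real l / pax_rate G", unfolded upd] mu
    by (simp add: field_simps)
qed

text \<open>Any solution of the recursion dominates \<open>l / \<mu>\<close>: by induction on the position \<open>l\<close>,
  and for fixed \<open>l\<close> downwards in the queue length, starting at the largest capacity, where nobody
  joins and the recursion for \<open>w n l\<close> involves only position \<open>l - 1\<close>.\<close>

lemma fcfs_least:
  fixes G :: "('m::finite) model" and w :: "nat \<Rightarrow> nat \<Rightarrow> real"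
  assumes adm: "admissible_model G"
    and we: "wait_equations G (fcfs_plan G N\<lparr>pos_wait := w\<rparr>)"
  shows "l \<in> {1..n+1} \<Longrightarrow> real l / pax_rate G \<le> w n l"
proof (induction l arbitrary: n)
  case 0
  then show ?case by simp
next
  case (Suc l)
  have mu: "pax_rate G > 0" using adm by (simp add: admissible_model_def)
  let ?a = "total_join_rate (fcfs_plan G N)"
  have a: "0 \<le> ?a k" for k by (rule threshold_join_bounds(3)[OF adm fcfs_threshold])
  have step: "real (Suc l) + ?a (Suc k) * w (Suc k) (Suc l) \<le> (?a (Suc k) + pax_rate G) * w k (Suc l)"
    if "l \<le> k" for k
  proof (cases "l = 0")
    case True
    have "wait_eq_front G (fcfs_plan G N\<lparr>pos_wait := w\<rparr>) k" using we by (simp add: wait_equations_def)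
    then show ?thesis using fcfs_eq_front[OF adm, where N = N and w = w and n = k] True by simp
  next
    case False
    have "wait_eq_behind G (fcfs_plan G N\<lparr>pos_wait := w\<rparr>) k (Suc l)"
      using we False that by (simp add: wait_equations_def)
    then have "(?a (Suc k) + pax_rate G) * w k (Suc l) =
        1 + ?a (Suc k) * w (Suc k) (Suc l) + pax_rate G * w (k - 1) l"
      using fcfs_eq_behind[OF adm, where l = "Suc l" and N = N and w = w and n = k] that by simp
    moreover have "real l / pax_rate G \<le> w (k - 1) l"
      by (rule Suc.IH) (use False that in auto)
    then have "real l \<le> pax_rate G * w (k - 1) l" using mu by (simp add: field_simps)
    ultimately show ?thesis by simp
  qed
  have bw: "real (Suc l) / pax_rate G \<le> w k (Suc l)"
    if "l \<le> k" "?a (Suc k) = 0 \<or> real (Suc l) / pax_rate G \<le> w (Suc k) (Suc l)" for k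
  proof -
    have "?a (Suc k) * (real (Suc l) / pax_rate G) \<le> ?a (Suc k) * w (Suc k) (Suc l)"
      using that(2) a[of "Suc k"] mult_left_mono by (metis mult_zero_left order_refl)
    then have "(?a (Suc k) + pax_rate G) * (real (Suc l) / pax_rate G) \<le> (?a (Suc k) + pax_rate G) * w k (Suc l)"
      using step[OF that(1)] mu by (simp only: distrib_right) simp
    then show ?thesis using a[of "Suc k"] mu by (smt (verit) mult_le_cancel_left_pos)
  qed
  have "l \<le> n" using Suc.prems by simp
  show ?case
  proof (cases "max_capacity N \<le> n")
    case True
    then show ?thesis
      using bw[OF \<open>l \<le> n\<close>] threshold_flows_zero(1)[OF fcfs_threshold[of G N], of "Suc n"] by simp
  next
    case False
    then have "n \<le> max_capacity N" by simp
    then show ?thesis using \<open>l \<le> n\<close>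
    proof (induction rule: inc_induct)
      case base
      then show ?case
        using bw threshold_flows_zero(1)[OF fcfs_threshold[of G N], of "Suc (max_capacity N)"] by simp
    next
      case (step k)
      then show ?case using bw[of k] by simp
    qed
  qed
qed

lemma fcfs_feasible:
  fixes G :: "('m::finite) model"
  assumes adm: "admissible_model G"
  shows "sw_feasible G (fcfs_plan G N)" and "lower_feasible G N (fcfs_plan G N)"
proof -
  have mu: "pax_rate G > 0" using adm by (simp add: admissible_model_def)
  have rj: "rational_joining G (fcfs_plan G N)"
    using fcfs_net_utility[OF adm] by (simp add: rational_joining_def)
  have "wait_equations G (fcfs_plan G N)"
    using fcfs_wait_equations[OF adm] by (simp add: wait_equations_def)
  moreover have "nonneg_pos_wait (fcfs_plan G N)"
    using mu by (simp add: nonneg_pos_wait_def)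
  ultimately have "expected_pos_wait G (fcfs_plan G N)"
    unfolding expected_pos_wait_def fcfs_simps using fcfs_least[OF adm] by blast
  then show "sw_feasible G (fcfs_plan G N)"
    by (simp add: sw_feasible_def rj fcfs_lotteries fcfs_steady_state)
  have "truncated_wait_equations G N (fcfs_plan G N)"
    unfolding truncated_wait_equations_def
    using fcfs_wait_equations[OF adm] mu by (auto simp: field_simps of_nat_diff)
  then show "lower_feasible G N (fcfs_plan G N)"
    using fcfs_net_utility[OF adm]
    by (simp add: lower_feasible_def fcfs_lotteries fcfs_steady_state fcfs_threshold)
qed

lemma fcfs_objectives_eq:
  fixes G :: "('m::finite) model"
  shows "sw_objective G (fcfs_plan G N) = lower_objective G N (fcfs_plan G N)"
proof -
  let ?S = "fcfs_plan G N"
  have "sw_objective G ?S =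
      (\<Sum>k<max_capacity N. prob ?S k * (\<Sum>m\<in>UNIV. join_rate ?S m k * social_gain G ?S m k))"
    unfolding sw_objective_def
  proof (rule suminf_finite)
    fix k assume "k \<notin> {..<max_capacity N}"
    then have "join_rate ?S m k = 0" for m
      using max_capacity_ge[of N m] by simp
    then show "prob ?S k * (\<Sum>m\<in>UNIV. join_rate ?S m k * social_gain G ?S m k) = 0"
      by (simp del: fcfs_simps)
  qed simp
  then show ?thesis
    using lower_objective_flow[OF fcfs_threshold max_capacity_ge, of G N] by (simp only: social_gain_flow)
qed

section \<open>Optimal thresholds\<close>

lemma admission_surplus_antimono:
  fixes G :: "('m::finite) model"
  assumes "admissible_model G" "v \<le> v'"
  shows "admission_surplus G v' \<le> admission_surplus G v"
  unfolding admission_surplus_def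
  by (intro sum_mono mult_left_mono) (use assms in \<open>auto simp: admissible_model_def less_imp_le\<close>)

lemma admission_surplus_onto:
  fixes G :: "('m::finite) model"
  assumes adm: "admissible_model G" and y: "0 \<le> y"
  shows "\<exists>v \<le> Max (range (admission_margin G)). admission_surplus G v = y"
proof -
  let ?B = "Max (range (admission_margin G))"
  have le: "admission_margin G m \<le> ?B" for m by simp
  have "?B \<in> range (admission_margin G)" by (rule Max_in) auto
  then obtain m where m: "?B = admission_margin G m" by (rule rangeE)
  have lam: "0 < drv_rate G m" for m using adm by (simp add: admissible_model_def)
  have zero: "admission_surplus G ?B = 0"
    unfolding admission_surplus_def by (intro sum.neutral) (simp add: le)
  define c where "c = ?B - y / drv_rate G m"
  have "y = drv_rate G m * max 0 (admission_margin G m - c)"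
    using lam[of m] y by (simp add: m[symmetric] c_def)
  also have "\<dots> \<le> admission_surplus G c"
    unfolding admission_surplus_def by (rule member_le_sum) (auto simp: lam less_imp_le)
  finally have "y \<le> admission_surplus G c" .
  moreover have "c \<le> ?B" using lam[of m] y by (simp add: c_def)
  moreover have "continuous_on {c..?B} (admission_surplus G)"
    unfolding admission_surplus_def[abs_def] by (intro continuous_intros)
  ultimately show ?thesis using IVT2'[of "admission_surplus G" ?B y c] zero y by auto
qed

text \<open>The optimality equation with average welfare \<open>g\<close>, solved forwards in \<open>k\<close>. The maximum with 0 is
  harmless as long as its argument is non-negative.\<close>

lemma bellman_sequence:
  fixes G :: "('m::finite) model"
  assumes adm: "admissible_model G"
  obtains u :: "nat \<Rightarrow> real" where "u 0 = 0" "\<And>k. u (Suc k) \<le> Max (range (admission_margin G))"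
    "\<And>k. admission_surplus G (u (Suc k)) = max 0 (g + holding_cost G * real k - pax_rate G * u k)"
proof -
  obtain \<psi> where \<psi>: "\<And>y. 0 \<le> y \<Longrightarrow> \<psi> y \<le> Max (range (admission_margin G)) \<and> admission_surplus G (\<psi> y) = y"
    using admission_surplus_onto[OF adm] by metis
  define u where "u = rec_nat 0 (\<lambda>k x. \<psi> (max 0 (g + holding_cost G * real k - pax_rate G * x)))"
  show ?thesis by (rule that[of u]) (simp_all add: u_def \<psi>)
qed

text \<open>If \<open>u\<close> satisfies the optimality equation below \<open>n\<close>, but the right-hand side becomes negative at
  \<open>n\<close>, then admitting no one from \<open>n\<close> on and the groups with margin at least \<open>u (k + 1)\<close> at queue
  lengths \<open>k < n\<close> has welfare above \<open>g\<close>.\<close>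

lemma improving_thresholds:
  fixes G :: "('m::finite) model" and u :: "nat \<Rightarrow> real"
  assumes adm: "admissible_model G" and u0: "u 0 = 0"
    and uB: "\<And>k. u (Suc k) \<le> Max (range (admission_margin G))"
    and bell: "\<And>k. k < n \<Longrightarrow> admission_surplus G (u (Suc k)) = g + holding_cost G * real k - pax_rate G * u k"
    and fail: "g + holding_cost G * real n < pax_rate G * u n"
  shows "\<exists>N. (\<forall>m. N m \<le> n) \<and> g < lower_objective G N (fcfs_plan G N)"
proof -
  define h where "h = holding_cost G"
  define \<mu> where "\<mu> = pax_rate G"
  have mu: "\<mu> > 0" and h: "h > 0" and lam: "\<And>m. 0 < drv_rate G m"
    using adm by (auto simp: admissible_model_def \<mu>_def h_def holding_cost_def)
  \<comment> \<open>The right-hand side drops from \<open>n - 1\<close> to \<open>n\<close>, which makes the last increment of \<open>u\<close> positive. As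
    \<open>admission_surplus\<close> is antitone, a positive increment forces the previous one to be positive.\<close>
  have inc: "u k < u (Suc k)" if "k < n" for k
  proof -
    have bw: "u k < u (Suc k)"
      if "g + h * real (Suc k) - \<mu> * u (Suc k) \<le> g + h * real k - \<mu> * u k" for k
    proof -
      have "h \<le> \<mu> * (u (Suc k) - u k)" using that by (simp add: algebra_simps)
      then have "0 < \<mu> * (u (Suc k) - u k)" using h by linarith
      then show ?thesis using mu by (simp add: zero_less_mult_iff)
    qed
    from that have "Suc k \<le> n" by simp
    then obtain i where "n = Suc k + i" using le_Suc_ex by blast
    with that bell fail show ?thesis
    proof (induction i arbitrary: k)
      case 0
      have "0 \<le> admission_surplus G (u (Suc k))"
        unfolding admission_surplus_def by (intro sum_nonneg) (simp add: lam less_imp_le)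
      then show ?case using bw[of k] bell[of k] 0 by (simp add: h_def \<mu>_def)
    next
      case (Suc i)
      have "u (Suc k) < u (Suc (Suc k))"
        by (rule Suc.IH) (use Suc in auto)
      then have "admission_surplus G (u (Suc (Suc k))) \<le> admission_surplus G (u (Suc k))"
        by (intro admission_surplus_antimono[OF adm]) simp
      then show ?case
        using bell[of k] bell[of "Suc k"] Suc.prems bw[of k] by (simp add: h_def \<mu>_def)
    qed
  qed
  have mono: "u (Suc j) \<le> u (Suc k)" if "j \<le> k" "k < n" for j k
    using that
  proof (induction rule: dec_induct)
    case (step i)
    then show ?case using inc[of "Suc i"] by simp
  qed simp
  \<comment> \<open>Since \<open>u\<close> is increasing, the groups admitted at each queue length are given by thresholds.\<close>
  define N where "N m = (LEAST k. n \<le> k \<or> admission_margin G m < u (Suc k))" for m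
  have Nle: "N m \<le> n" for m unfolding N_def by (rule Least_le) simp
  have Niff: "k < N m \<longleftrightarrow> k < n \<and> u (Suc k) \<le> admission_margin G m" for m k
  proof
    assume "k < N m"
    then have "\<not> (n \<le> k \<or> admission_margin G m < u (Suc k))"
      unfolding N_def by (rule not_less_Least)
    then show "k < n \<and> u (Suc k) \<le> admission_margin G m" by auto
  next
    assume k: "k < n \<and> u (Suc k) \<le> admission_margin G m"
    have "n \<le> N m \<or> admission_margin G m < u (Suc (N m))"
      unfolding N_def by (rule LeastI[where k = n]) simp
    then show "k < N m" using k mono[of "N m" k] by fastforce
  qed
  let ?S = "fcfs_plan G N"
  note ss = fcfs_steady_state[of G N] and th = fcfs_threshold[of G N]
  have bal: "\<mu> * prob ?S (Suc k) = total_join_rate ?S k * prob ?S k" for k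
    using steady_state_balance[OF ss] mu by (simp add: \<mu>_def)
  have cap: "max_capacity N \<le> n" using Nle by (simp add: max_capacity_def)
  have flow: "margin_flow G ?S k - total_join_rate ?S k * u (Suc k) = admission_surplus G (u (Suc k))"
    if "k < n" for k
  proof -
    have "margin_flow G ?S k - total_join_rate ?S k * u (Suc k) =
        (\<Sum>m\<in>UNIV. join_rate ?S m k * (admission_margin G m - u (Suc k)))"
      by (simp add: margin_flow_def total_join_rate_def sum_distrib_right right_diff_distrib sum_subtractf
          del: fcfs_simps)
    also have "\<dots> = admission_surplus G (u (Suc k))"
      unfolding admission_surplus_def by (rule sum.cong) (use that in \<open>auto simp: Niff\<close>)
    finally show ?thesis .
  qed
  \<comment> \<open>Groups with margin equal to the price are admitted: this makes a group of largest margin join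
    at all \<open>k < n\<close>, so queue length \<open>n\<close> has positive probability and the improvement is strict.\<close>
  have ppos: "k \<le> n \<Longrightarrow> prob ?S k > 0" for k
  proof (induction k)
    case 0
    show ?case
      using steady_state_prob(1)[OF ss] mu threshold_join_bounds(3)[OF adm th] by (simp add: \<mu>_def)
  next
    case (Suc k)
    have "Max (range (admission_margin G)) \<in> range (admission_margin G)" by (rule Max_in) auto
    then obtain m where "Max (range (admission_margin G)) = admission_margin G m" by (rule rangeE)
    then have "k < N m" using uB[of k] Suc.prems by (simp add: Niff)
    then have "0 < join_rate ?S m k" using lam by simp
    moreover have "join_rate ?S m k \<le> total_join_rate ?S k"
      unfolding total_join_rate_def
      by (rule member_le_sum) (use threshold_join_bounds(1)[OF adm th] in auto)
    ultimately have "0 < \<mu> * prob ?S (Suc k)" using Suc unfolding bal by simp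
    then show ?case using mu by (simp add: zero_less_mult_iff)
  qed
  have "lower_objective G N ?S = (\<Sum>k\<le>n. prob ?S k * (margin_flow G ?S k - h * real k))"
    unfolding h_def by (rule lower_objective_eq[OF adm fcfs_feasible(2)[OF adm] cap])
  also have "\<dots> = (\<Sum>k<n. prob ?S k * (margin_flow G ?S k - h * real k)) - prob ?S n * (h * real n)"
    using threshold_flows_zero(2)[OF th cap] by (simp add: lessThan_Suc_atMost[symmetric])
  also have "(\<Sum>k<n. prob ?S k * (margin_flow G ?S k - h * real k)) =
      (\<Sum>k<n. prob ?S k * (margin_flow G ?S k - h * real k - total_join_rate ?S k * u (Suc k) + \<mu> * u k))
        + \<mu> * prob ?S n * u n"
    by (rule balanced_sum[where P = "prob ?S" and a = "total_join_rate ?S" and u = u, OF bal u0])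
  also have "(\<Sum>k<n. prob ?S k * (margin_flow G ?S k - h * real k - total_join_rate ?S k * u (Suc k) + \<mu> * u k)) =
      (\<Sum>k<n. prob ?S k * g)"
  proof (intro sum.cong refl)
    fix k assume "k \<in> {..<n}"
    then show "prob ?S k * (margin_flow G ?S k - h * real k - total_join_rate ?S k * u (Suc k) + \<mu> * u k) = prob ?S k * g"
      using flow[of k] bell[of k] by (simp add: h_def \<mu>_def)
  qed
  also have "(\<Sum>k<n. prob ?S k * g) = g - prob ?S n * g"
  proof -
    have "(\<Sum>k<n. prob ?S k) = 1 - prob ?S n"
      using threshold_prob(2)[OF adm th ss cap] by (simp add: lessThan_Suc_atMost[symmetric])
    then show ?thesis by (simp add: sum_distrib_right[symmetric] left_diff_distrib)
  qed
  finally have "lower_objective G N ?S = g + prob ?S n * (\<mu> * u n - (g + h * real n))"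
    by (simp add: algebra_simps)
  moreover have "0 < prob ?S n * (\<mu> * u n - (g + h * real n))"
    using ppos[of n] fail by (simp add: h_def \<mu>_def)
  ultimately show ?thesis using Nle by (intro exI[of _ N]) auto
qed

text \<open>The best thresholds, together with a sequence \<open>u\<close> that certifies their optimality.\<close>

lemma optimal_thresholds:
  fixes G :: "('m::finite) model"
  assumes adm: "admissible_model G"
  obtains u B N where "u 0 = 0" "\<And>k. u k \<le> B"
    "\<And>k. admission_surplus G (u (Suc k)) \<le>
      lower_objective G N (fcfs_plan G N) + holding_cost G * real k - pax_rate G * u k"
proof -
  define h where "h = holding_cost G"
  define \<mu> where "\<mu> = pax_rate G"
  have mu: "\<mu> > 0" and h: "h > 0"
    using adm by (auto simp: admissible_model_def \<mu>_def h_def holding_cost_def)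
  let ?B = "Max (range (admission_margin G))"
  \<comment> \<open>A failure at \<open>n\<close> means \<open>h * n < \<mu> * u n\<close>, where \<open>u n\<close> is at most the largest margin; hence
    capacities up to \<open>K\<close> suffice.\<close>
  define K where "K = nat \<lceil>\<mu> * ?B / h\<rceil>"
  let ?val = "\<lambda>N. lower_objective G N (fcfs_plan G N)"
  let ?T = "{N :: 'm \<Rightarrow> nat. \<forall>m. N m \<le> K}"
  have "?T = PiE UNIV (\<lambda>_. {..K})" by auto
  then have fin: "finite ?T" by (simp add: finite_PiE)
  have ne: "?T \<noteq> {}" by (auto intro!: exI[of _ "\<lambda>_. 0"])
  have "Max (?val ` ?T) \<in> ?val ` ?T" using fin ne by (intro Max_in) auto
  then obtain N where N: "N \<in> ?T" "?val N = Max (?val ` ?T)" by auto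
  have best: "?val N' \<le> ?val N" if "\<And>m. N' m \<le> K" for N'
    unfolding N(2) using fin that by (intro Max_ge) auto
  have g0: "0 \<le> ?val N" using best[of "\<lambda>_. 0"] by (simp add: lower_objective_def)
  obtain u where u: "u 0 = 0" "\<And>k. u (Suc k) \<le> ?B"
    "\<And>k. admission_surplus G (u (Suc k)) = max 0 (?val N + holding_cost G * real k - pax_rate G * u k)"
    using bellman_sequence[OF adm] by blast
  have ok: "pax_rate G * u n \<le> ?val N + holding_cost G * real n" for n
  proof (induction n rule: less_induct)
    case (less n)
    show ?case
    proof (rule ccontr)
      assume "\<not> ?case"
      then have fail: "?val N + holding_cost G * real n < pax_rate G * u n" by simp
      have "\<exists>N'. (\<forall>m. N' m \<le> n) \<and> ?val N < ?val N'"
        by (rule improving_thresholds[OF adm u(1,2) _ fail]) (use u(3) less in auto)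
      then obtain N' where N': "\<And>m. N' m \<le> n" "?val N < ?val N'" by auto
      have "n \<noteq> 0"
      proof
        assume "n = 0"
        with fail g0 u(1) show False by simp
      qed
      then have "u n \<le> ?B" using u(2)[of "n - 1"] by simp
      then have "\<mu> * u n \<le> \<mu> * ?B" using mu by simp
      then have "h * real n \<le> \<mu> * ?B" using fail g0 by (simp add: h_def \<mu>_def)
      then have "real n \<le> \<mu> * ?B / h" using h by (simp add: field_simps)
      then have "n \<le> K" unfolding K_def by linarith
      then have "?val N' \<le> ?val N" using N'(1) by (intro best) (meson order_trans)
      with N'(2) show False by simp
    qed
  qed
  show ?thesis
  proof (rule that[of u "max 0 ?B" N])
    show "u k \<le> max 0 ?B" for k using u(1) u(2)[of "k - 1"] by (cases k) auto
    show "admission_surplus G (u (Suc k)) \<le> ?val N + holding_cost G * real k - pax_rate G * u k" for k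
      using u(3)[of k] ok[of k] by simp
  qed (rule u(1))
qed

theorem proposition6:
  fixes G :: "('m::finite) model"
  assumes "admissible_model G"
  shows "bilevel_value G = sw_value G \<and>
    (\<exists>N S S'. bilevel_optimal G N S \<and> sw_optimal G S' \<and> completed_by N S S')"
proof (rule optimal_thresholds[OF assms])
  fix u :: "nat \<Rightarrow> real" and B N
  assume u: "u 0 = 0" "\<And>k. u k \<le> B"
    "\<And>k. admission_surplus G (u (Suc k)) \<le>
      lower_objective G N (fcfs_plan G N) + holding_cost G * real k - pax_rate G * u k"
  define S where "S = fcfs_plan G N"
  define g where "g = lower_objective G N S"
  have feas: "sw_feasible G S" "lower_feasible G N S"
    using fcfs_feasible[OF assms] by (simp_all add: S_def)
  have obj: "sw_objective G S = g"
    using fcfs_objectives_eq by (simp add: S_def g_def)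
  have lb: "lower_objective G N' S' \<le> g" if "lower_feasible G N' S'" for N' S'
    unfolding g_def S_def by (rule lower_objective_le[OF assms that u(1,3)])
  have sb: "sw_objective G S' \<le> g" if "sw_feasible G S'" for S'
    unfolding g_def S_def by (rule sw_objective_le[OF assms that u(1,3,2)])
  have lv: "lower_value G N' \<le> ereal g" for N'
    unfolding lower_value_def by (rule SUP_least) (simp add: lb)
  have lvN: "lower_value G N = ereal g"
    by (rule antisym[OF lv]) (use feas in \<open>auto simp: lower_value_def g_def intro!: SUP_upper2[of S]\<close>)
  have "bilevel_value G = ereal g"
    unfolding bilevel_value_def
    by (rule antisym) (use lv lvN in \<open>auto intro!: SUP_least SUP_upper2[of N]\<close>)
  moreover have "sw_value G = ereal g"
    unfolding sw_value_def
    by (rule antisym) (use feas obj sb in \<open>auto intro!: SUP_least SUP_upper2[of S]\<close>)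
  moreover have "bilevel_optimal G N S"
    using lv lvN feas(2) lb by (simp add: bilevel_optimal_def g_def)
  moreover have "sw_optimal G S"
    using feas(1) sb obj by (simp add: sw_optimal_def)
  moreover have "completed_by N S S"
    by (simp add: completed_by_def S_def)
  ultimately show ?thesis by auto
qed

end
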